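(* Let $G$ be a 2-connected 4-regular planar graph, possibly with multiple edges. Let $\hat G$ and $\hat G'$ be any two planar embeddings of $G$, and let $C$ and $C'$ be the threaded circuit partitions of the plane graphs $\hat G$ and $\hat G'$, respectively. Then $|C| = |C'|$.
   Context: A plane graph is a graph with a fixed planar embedding, encoded by the cyclic counterclockwise order of edge-ends (half-edges) at each vertex. Threads. In a 4-regular plane graph, let $h_0,h_1,h_2,h_3$ be the edge-ends at a vertex $\beta$ in cyclic order. The two threads with midpoint $\beta$ are the pairs of non-consecutive edge-ends $\{h_0,h_2\}$ and $\{h_1,h_3\}$. Equivalently, a thread is a two-edge path $(\alpha,\beta,\gamma)$ whose edge-ends at $\beta$ are not contiguous in the cyclic order around $\beta$. For each edge traversal $(\alpha,\beta)$ there is a unique thread $(\alpha,\beta,\gamma)$. Threaded circuits. A circuit is a cyclic sequence of distinct edges $(e_0,\dots,e_{k-1})$ with $e_i=(u_i,u_{i+1})$, indices mod $k$. It is threaded if each $(u_{j-1},u_j,u_{j+1})$ is a thread. Threaded circuit partition. A threaded circuit partition is a set of threaded circuits in which each edge lies in exactly one circuit. Every 4-regular plane graph has exactly one threaded circuit partition, so the partition depends on the chosen embedding. *)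

theory Defs
  imports Main
begin

text \<open>A finite loopless multigraph: vertex set V, edge set E, and each edge e has
  two distinct end vertices ends e. Edge-ends (half-edges, darts) are pairs (e, b):
  (e, True) is the end of e at fst (ends e), (e, False) the end at snd (ends e).\<close>

definition darts :: "'e set \<Rightarrow> ('e \<times> bool) set" where
  "darts E = E \<times> UNIV"

definition dvert :: "('e \<Rightarrow> 'v \<times> 'v) \<Rightarrow> 'e \<times> bool \<Rightarrow> 'v" where
  "dvert ends d = (if snd d then fst (ends (fst d)) else snd (ends (fst d)))"

text \<open>The other end of the same edge.\<close>
definition opp :: "'e \<times> bool \<Rightarrow> 'e \<times> bool" where
  "opp d = (fst d, \<not> snd d)"

definition multigraph :: "'v set \<Rightarrow> 'e set \<Rightarrow> ('e \<Rightarrow> 'v \<times> 'v) \<Rightarrow> bool" where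
  "multigraph V E ends \<longleftrightarrow> finite V \<and> finite E \<and>
     (\<forall>e\<in>E. fst (ends e) \<in> V \<and> snd (ends e) \<in> V \<and> fst (ends e) \<noteq> snd (ends e))"

definition four_regular :: "'v set \<Rightarrow> 'e set \<Rightarrow> ('e \<Rightarrow> 'v \<times> 'v) \<Rightarrow> bool" where
  "four_regular V E ends \<longleftrightarrow> (\<forall>v\<in>V. card {d \<in> darts E. dvert ends d = v} = 4)"

definition adj_in :: "'e set \<Rightarrow> ('e \<Rightarrow> 'v \<times> 'v) \<Rightarrow> 'v set \<Rightarrow> ('v \<times> 'v) set" where
  "adj_in E ends S = {(u, w). u \<in> S \<and> w \<in> S \<and> (\<exists>e\<in>E. ends e = (u, w) \<or> ends e = (w, u))}"

text \<open>The subgraph induced on S is connected.\<close>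
definition connected_on :: "'e set \<Rightarrow> ('e \<Rightarrow> 'v \<times> 'v) \<Rightarrow> 'v set \<Rightarrow> bool" where
  "connected_on E ends S \<longleftrightarrow> (\<forall>u\<in>S. \<forall>w\<in>S. (u, w) \<in> (adj_in E ends S)\<^sup>*)"

definition two_connected :: "'v set \<Rightarrow> 'e set \<Rightarrow> ('e \<Rightarrow> 'v \<times> 'v) \<Rightarrow> bool" where
  "two_connected V E ends \<longleftrightarrow> card V \<ge> 3 \<and> connected_on E ends V \<and>
     (\<forall>v\<in>V. connected_on E ends (V - {v}))"

text \<open>An embedding (rotation system): a permutation of the edge-ends whose cycles are
  exactly the sets of edge-ends at each vertex (the counterclockwise cyclic order).\<close>
definition rotation_system ::
  "'v set \<Rightarrow> 'e set \<Rightarrow> ('e \<Rightarrow> 'v \<times> 'v) \<Rightarrow> ('e \<times> bool \<Rightarrow> 'e \<times> bool) \<Rightarrow> bool" where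
  "rotation_system V E ends \<sigma> \<longleftrightarrow> bij_betw \<sigma> (darts E) (darts E) \<and>
     (\<forall>d\<in>darts E. {(\<sigma> ^^ n) d | n. True} = {d' \<in> darts E. dvert ends d' = dvert ends d})"

text \<open>Faces of the embedding: orbits of sigma composed with the edge involution.\<close>
definition faces :: "'e set \<Rightarrow> ('e \<times> bool \<Rightarrow> 'e \<times> bool) \<Rightarrow> ('e \<times> bool) set set" where
  "faces E \<sigma> = (\<lambda>d. {((\<sigma> \<circ> opp) ^^ n) d | n. True}) ` darts E"

text \<open>Planar embedding of a connected graph: a rotation system of genus 0 (Euler).\<close>
definition planar_embedding ::
  "'v set \<Rightarrow> 'e set \<Rightarrow> ('e \<Rightarrow> 'v \<times> 'v) \<Rightarrow> ('e \<times> bool \<Rightarrow> 'e \<times> bool) \<Rightarrow> bool" where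
  "planar_embedding V E ends \<sigma> \<longleftrightarrow> rotation_system V E ends \<sigma> \<and>
     int (card V) - int (card E) + int (card (faces E \<sigma>)) = 2"

text \<open>Two edge-ends h, h' at a vertex of degree 4 form a thread iff they are
  non-consecutive in the cyclic order, i.e. opposite.\<close>
definition is_thread :: "('e \<times> bool \<Rightarrow> 'e \<times> bool) \<Rightarrow> 'e \<times> bool \<Rightarrow> 'e \<times> bool \<Rightarrow> bool" where
  "is_thread \<sigma> h h' \<longleftrightarrow> h' = \<sigma> (\<sigma> h) \<or> h = \<sigma> (\<sigma> h')"

text \<open>A threaded circuit, given by the list of its edges e_i each with its end d_i at u_i
  (so e_i goes from u_i = dvert d_i to u_(i+1) = dvert (opp d_i)); edges are distinct and
  at each u_(i+1) the ends opp d_i and d_(i+1) form a thread.\<close>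
definition threaded_circuit ::
  "'e set \<Rightarrow> ('e \<Rightarrow> 'v \<times> 'v) \<Rightarrow> ('e \<times> bool \<Rightarrow> 'e \<times> bool) \<Rightarrow> ('e \<times> bool) list \<Rightarrow> bool" where
  "threaded_circuit E ends \<sigma> ds \<longleftrightarrow> ds \<noteq> [] \<and> set ds \<subseteq> darts E \<and> distinct (map fst ds) \<and>
     (\<forall>i<length ds. dvert ends (ds ! ((i + 1) mod length ds)) = dvert ends (opp (ds ! i)) \<and>
        is_thread \<sigma> (opp (ds ! i)) (ds ! ((i + 1) mod length ds)))"

text \<open>A threaded circuit partition, each circuit represented by its edge set.\<close>
definition threaded_circuit_partition ::
  "'e set \<Rightarrow> ('e \<Rightarrow> 'v \<times> 'v) \<Rightarrow> ('e \<times> bool \<Rightarrow> 'e \<times> bool) \<Rightarrow> 'e set set \<Rightarrow> bool" where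
  "threaded_circuit_partition E ends \<sigma> P \<longleftrightarrow>
     (\<forall>S\<in>P. \<exists>ds. threaded_circuit E ends \<sigma> ds \<and> S = fst ` set ds) \<and>
     (\<forall>S\<in>P. \<forall>S'\<in>P. S \<noteq> S' \<longrightarrow> S \<inter> S' = {}) \<and> \<Union>P = E"

end

theory Submission
  imports Defs
begin

text \<open>
  Work over the field with two elements. Let Z be the cycle space of G (the even edge sets), and
  let R be the space of elements of Z that at every vertex take equal values on opposite edge-ends;
  the threaded circuits form a basis of R, so R has 2 ^ card C elements.

  By Euler's formula every element of Z is the coboundary of a 2-colouring of the faces. In
  particular Z contains E, so the faces fall into black and white ones, and keeping the colouring on
  the black faces only defines, up to constants at each vertex, a projection e of Z that acts on
  each vertex separately. A second embedding gives another such projection e'. With s = e + e', the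
  map g = 1 + s + s * s preserves Z, and a check of the six relative cyclic orders at a vertex shows
  that g carries the opposite pairing of the first embedding to that of the second. Hence g embeds R
  into R', modulo the constant E, and by symmetry R and R' have equally many elements.
\<close>

section \<open>Parities of finite cardinalities\<close>

lemma odd_card_sym_diff:
  assumes "finite A" "finite B"
  shows "odd (card (sym_diff A B)) \<longleftrightarrow> odd (card A) \<noteq> odd (card B)"
proof -
  have "card (sym_diff A B) = card (A - B) + card (B - A)"
    using assms by (intro card_Un_disjoint) auto
  moreover have "card A = card (A - B) + card (A \<inter> B)"
    using assms by (metis add.commute card_Diff_subset_Int card_mono finite_Int inf_le1 le_add_diff_inverse)
  moreover have "card B = card (B - A) + card (A \<inter> B)"
    using assms by (metis Int_commute add.commute card_Diff_subset_Int card_mono finite_Int inf_le1 le_add_diff_inverse)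
  ultimately show ?thesis by auto
qed

lemma even_card_four:
  assumes "a \<noteq> b" "a \<noteq> c" "a \<noteq> d" "b \<noteq> c" "b \<noteq> d" "c \<noteq> d"
  shows "even (card {x \<in> {a, b, c, d}. P x}) \<longleftrightarrow> ((P a \<noteq> P b) \<longleftrightarrow> (P c \<noteq> P d))"
proof -
  have "{x \<in> {a, b, c, d}. P x} =
    (if P a then {a} else {}) \<union> (if P b then {b} else {}) \<union> (if P c then {c} else {}) \<union> (if P d then {d} else {})"
    by auto
  then show ?thesis using assms by (auto simp: card_insert_if)
qed

subsection \<open>Orbits of a permutation of a finite set\<close>

abbreviation forward_orbit :: "('a \<Rightarrow> 'a) \<Rightarrow> 'a \<Rightarrow> 'a set" where
  "forward_orbit f x \<equiv> {(f ^^ n) x | n. True}"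

lemma funpow_in:
  assumes "bij_betw f A A" "x \<in> A"
  shows "(f ^^ n) x \<in> A"
  using assms by (induction n) (auto simp: bij_betw_def)

lemma funpow_cancel:
  assumes "bij_betw f A A" "x \<in> A" "i \<le> j" "(f ^^ i) x = (f ^^ j) x"
  shows "(f ^^ (j - i)) x = x"
  using assms(3,4)
proof (induction i arbitrary: j)
  case (Suc i)
  then obtain j' where j: "j = Suc j'" by (cases j) auto
  have "f ((f ^^ i) x) = f ((f ^^ j') x)" using Suc.prems j by simp
  then have "(f ^^ i) x = (f ^^ j') x"
    using assms funpow_in[OF assms(1,2)] by (meson bij_betw_def inj_onD)
  then show ?case using Suc j by simp
qed simp

lemma forward_orbit_bounded:
  assumes "0 < k" "(f ^^ k) x = x"
  shows "forward_orbit f x = (\<lambda>i. (f ^^ i) x) ` {..<k}"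
proof -
  have "(f ^^ n) x = (f ^^ (n mod k)) x" for n
    using funpow_mod_eq[OF assms(2)] by simp
  moreover have "n mod k \<in> {..<k}" for n using assms by simp
  ultimately show ?thesis by blast
qed

lemma funpow_period:
  assumes "finite A" "bij_betw f A A" "x \<in> A"
  obtains k where "0 < k" "(f ^^ k) x = x"
proof -
  have "(\<lambda>n. (f ^^ n) x) ` UNIV \<subseteq> A" using funpow_in[OF assms(2,3)] by auto
  then have "finite (range (\<lambda>n. (f ^^ n) x))" using assms(1) finite_subset by blast
  then have "\<not> inj (\<lambda>n. (f ^^ n) x)" using finite_imageD by blast
  then obtain i j where "i \<noteq> j" "(f ^^ i) x = (f ^^ j) x" by (auto simp: inj_on_def)
  then have "\<exists>i j. i < j \<and> (f ^^ i) x = (f ^^ j) x" by (metis linorder_neqE_nat)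
  then obtain i j where "i < j" "(f ^^ i) x = (f ^^ j) x" by blast
  then show thesis using that[of "j - i"] funpow_cancel[OF assms(2,3), of i j] by auto
qed

lemma forward_orbit_eq:
  assumes "finite A" "bij_betw f A A" "x \<in> A" "y \<in> forward_orbit f x"
  shows "forward_orbit f y = forward_orbit f x"
proof -
  obtain n where y: "y = (f ^^ n) x" using assms(4) by blast
  obtain k where k: "0 < k" "(f ^^ k) x = x" using funpow_period[OF assms(1-3)] .
  \<comment> \<open>Going on from \<open>y\<close> to the multiple \<open>k * n\<close> of the
    period leads back to \<open>x\<close>; \<open>0 < k\<close> keeps the subtraction from
    truncating.\<close>
  have x: "x = (f ^^ (k * n - n)) y"
  proof -
    have "(f ^^ (k * n)) x = x"
      using k(2) funpow_mod_eq[OF k(2), of "k * n"] by simp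
    moreover have "k * n - n + n = k * n" using k(1) by simp
    ultimately show ?thesis unfolding y
      by (metis comp_apply funpow_add)
  qed
  have "(f ^^ m) y \<in> forward_orbit f x" for m
    unfolding y by (metis (mono_tags, lifting) comp_apply funpow_add mem_Collect_eq)
  moreover have "(f ^^ m) x \<in> forward_orbit f y" for m
    by (subst x) (metis (mono_tags, lifting) comp_apply funpow_add mem_Collect_eq)
  ultimately show ?thesis by blast
qed

text \<open>An orbit has at most as many points as any period of \<open>x\<close>, so every period
  is at least four. Hence the first four iterates are distinct and fill the orbit, and
  \<open>(f ^^ 4) x\<close> can only be \<open>x\<close>, since any other coincidence would give a
  shorter period.\<close>

lemma orbit_of_card_four:
  assumes "bij_betw f A A" "x \<in> A" "card (forward_orbit f x) = 4"
  shows "distinct [x, f x, f (f x), f (f (f x))]"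
    and "f (f (f (f x))) = x"
    and "forward_orbit f x = {x, f x, f (f x), f (f (f x))}"
proof -
  have big: "4 \<le> k" if "0 < k" "(f ^^ k) x = x" for k
  proof -
    have "card (forward_orbit f x) \<le> card {..<k}"
      unfolding forward_orbit_bounded[OF that] by (rule card_image_le) simp
    then show ?thesis using assms(3) by simp
  qed
  have inj: "inj_on (\<lambda>i. (f ^^ i) x) {..<4}"
  proof (rule linorder_inj_onI)
    fix i j :: nat assume ij: "i < j" "j \<in> {..<4}"
    show "(f ^^ i) x \<noteq> (f ^^ j) x"
    proof
      assume "(f ^^ i) x = (f ^^ j) x"
      then show False
        using big[of "j - i"] funpow_cancel[OF assms(1,2), of i j] ij by auto
    qed
  qed auto
  have four: "{..<4} = {0, 1, 2, 3 :: nat}" by auto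
  have fin: "finite (forward_orbit f x)" using assms(3) card.infinite by fastforce
  have orb: "forward_orbit f x = (\<lambda>i. (f ^^ i) x) ` {..<4}"
    using inj fin assms(3) by (intro card_subset_eq[symmetric]) (auto simp: card_image)
  then show "forward_orbit f x = {x, f x, f (f x), f (f (f x))}"
    unfolding four by (simp add: eval_nat_numeral)
  show "distinct [x, f x, f (f x), f (f (f x))]"
    using inj unfolding four by (auto simp: eval_nat_numeral inj_on_def)
  have "(f ^^ 4) x \<in> forward_orbit f x" by blast
  then obtain i where i: "i < 4" "(f ^^ i) x = (f ^^ 4) x" unfolding orb by auto
  then have "i = 0"
    using big[of "4 - i"] funpow_cancel[OF assms(1,2), of i 4] by auto
  then show "f (f (f (f x))) = x" using i(2) by (simp add: eval_nat_numeral)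
qed

subsection \<open>Even edge sets\<close>

definition degree_in :: "('e \<Rightarrow> 'v \<times> 'v) \<Rightarrow> 'e set \<Rightarrow> 'v \<Rightarrow> nat" where
  "degree_in ends z v = card {d \<in> darts z. dvert ends d = v}"

definition even_edge_sets :: "'v set \<Rightarrow> 'e set \<Rightarrow> ('e \<Rightarrow> 'v \<times> 'v) \<Rightarrow> 'e set set" where
  "even_edge_sets V E ends = {z. z \<subseteq> E \<and> (\<forall>v\<in>V. even (degree_in ends z v))}"

lemma opp_opp [simp]: "opp (opp d) = d"
  and fst_opp [simp]: "fst (opp d) = fst d"
  by (simp_all add: opp_def)

lemma opp_in_darts [simp]: "opp d \<in> darts E \<longleftrightarrow> d \<in> darts E"
  by (cases d) (auto simp: opp_def darts_def)

lemma odd_degree_sym_diff: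
  assumes "finite x" "finite y"
  shows "odd (degree_in ends (sym_diff x y) v) \<longleftrightarrow> odd (degree_in ends x v) \<noteq> odd (degree_in ends y v)"
proof -
  have "{d \<in> darts (sym_diff x y). dvert ends d = v} =
      sym_diff {d \<in> darts x. dvert ends d = v} {d \<in> darts y. dvert ends d = v}"
    by (auto simp: darts_def)
  moreover have "finite (darts x)" "finite (darts y)" using assms by (auto simp: darts_def)
  ultimately show ?thesis by (simp add: degree_in_def odd_card_sym_diff)
qed

lemma even_edge_sets_sym_diff:
  assumes "finite E" "x \<in> even_edge_sets V E ends" "y \<in> even_edge_sets V E ends"
  shows "sym_diff x y \<in> even_edge_sets V E ends"
proof -
  have "finite x" "finite y"
    using assms finite_subset unfolding even_edge_sets_def by blast+
  then have "even (degree_in ends (sym_diff x y) v)" if "v \<in> V" for v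
    using assms that odd_degree_sym_diff[of x y ends v] by (simp add: even_edge_sets_def)
  then show ?thesis using assms unfolding even_edge_sets_def by auto
qed

lemma odd_degree_single:
  assumes "fst (ends e) \<noteq> snd (ends e)"
  shows "odd (degree_in ends {e} v) \<longleftrightarrow> v = fst (ends e) \<or> v = snd (ends e)"
proof -
  have "{d \<in> darts {e}. dvert ends d = v} =
     (if v = fst (ends e) then {(e, True)} else {}) \<union> (if v = snd (ends e) then {(e, False)} else {})"
    by (auto simp: darts_def dvert_def split: if_splits)
  then show ?thesis using assms by (auto simp: degree_in_def)
qed

text \<open>The edges of a walk are added modulo 2, each new edge moving the odd vertex from
  \<open>x\<close> to \<open>y\<close>. The inequality of truth values also covers closed walks,
  where \<open>u = w\<close>.\<close>

lemma path_with_odd_ends: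
  assumes "multigraph V E ends" "(u, w) \<in> (adj_in E ends S)\<^sup>*"
  shows "\<exists>z\<subseteq>E. \<forall>v. odd (degree_in ends z v) \<longleftrightarrow> (v = u) \<noteq> (v = w)"
  using assms(2)
proof (induction rule: rtrancl_induct)
  case base
  then show ?case by (intro exI[of _ "{}"]) (simp add: degree_in_def darts_def)
next
  case (step x y)
  then obtain z where z: "z \<subseteq> E" "\<And>v. odd (degree_in ends z v) \<longleftrightarrow> (v = u) \<noteq> (v = x)" by auto
  obtain e where e: "e \<in> E" "ends e = (x, y) \<or> ends e = (y, x)"
    using step(2) by (auto simp: adj_in_def)
  have fin: "finite z" and ne: "fst (ends e) \<noteq> snd (ends e)"
    using assms(1) z(1) e(1) finite_subset by (auto simp: multigraph_def)
  have "odd (degree_in ends {e} v) \<longleftrightarrow> (v = x) \<noteq> (v = y)" for v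
    unfolding odd_degree_single[of ends e v, OF ne] using ne e(2) by (cases "ends e") auto
  then have "odd (degree_in ends (sym_diff z {e}) v) \<longleftrightarrow> (v = u) \<noteq> (v = y)" for v
    using odd_degree_sym_diff[OF fin, of "{e}" ends v] z(2)[of v] by simp argo
  then show ?case using z(1) e(1) by (intro exI[of _ "sym_diff z {e}"]) auto
qed

text \<open>Even edge sets form the kernel of the boundary map over the two-element field, and by
  connectedness every parity pattern away from \<open>v0\<close> is a boundary. This bounds the
  dimension of the cycle space by |E| - |V| + 1.\<close>

lemma card_even_edge_sets_le:
  assumes mg: "multigraph V E ends" and con: "connected_on E ends V" and v0: "v0 \<in> V"
  shows "card (even_edge_sets V E ends) * 2 ^ (card V - 1) \<le> 2 ^ card E"
proof -
  have fin: "finite V" "finite E" using mg by (auto simp: multigraph_def)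
  have fs: "finite z" if "z \<subseteq> E" for z using that fin finite_subset by blast
  have "\<exists>z\<subseteq>E. \<forall>v\<in>V - {v0}. odd (degree_in ends z v) \<longleftrightarrow> v \<in> S" if "S \<subseteq> V - {v0}" for S
  proof -
    have "finite S" using that fin finite_subset by blast
    then show ?thesis using that
    proof (induction S rule: finite_induct)
      case empty
      then show ?case by (intro exI[of _ "{}"]) (simp add: degree_in_def darts_def)
    next
      case (insert u S)
      then obtain z where z: "z \<subseteq> E" "\<forall>v\<in>V - {v0}. odd (degree_in ends z v) \<longleftrightarrow> v \<in> S" by auto
      \<comment> \<open>A path from \<open>v0\<close> to \<open>u\<close> changes the parity at
        \<open>u\<close> and otherwise only at \<open>v0\<close>, where nothing is
        prescribed.\<close>
      have "(v0, u) \<in> (adj_in E ends V)\<^sup>*" using con v0 insert.prems by (auto simp: connected_on_def)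
      from path_with_odd_ends[OF mg this] obtain y
        where y: "y \<subseteq> E" "\<forall>v. odd (degree_in ends y v) \<longleftrightarrow> (v = v0) \<noteq> (v = u)"
        by (elim exE conjE)
      have "odd (degree_in ends (sym_diff z y) v) \<longleftrightarrow> v \<in> insert u S" if "v \<in> V - {v0}" for v
      proof -
        have "odd (degree_in ends z v) \<longleftrightarrow> v \<in> S" "odd (degree_in ends y v) \<longleftrightarrow> v = u"
          using z(2) y(2) that by blast+
        then show ?thesis
          using insert.hyps(2) unfolding odd_degree_sym_diff[OF fs[OF z(1)] fs[OF y(1)]] by blast
      qed
      moreover have "sym_diff z y \<subseteq> E" using y(1) z(1) by blast
      ultimately show ?case by blast
    qed
  qed
  \<comment> \<open>The boundary map has rank at least |V| - 1: r is a section of it away from v0.\<close>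
  then obtain r where r: "\<And>S. S \<subseteq> V - {v0} \<Longrightarrow> r S \<subseteq> E"
      "\<And>S v. S \<subseteq> V - {v0} \<Longrightarrow> v \<in> V - {v0} \<Longrightarrow> odd (degree_in ends (r S) v) \<longleftrightarrow> v \<in> S"
    by metis
  let ?Z = "even_edge_sets V E ends"
  let ?f = "\<lambda>(z, S). sym_diff z (r S)"
  have ZE: "z \<subseteq> E" if "z \<in> ?Z" for z using that by (simp add: even_edge_sets_def)
  have odd: "odd (degree_in ends (?f (z, S)) v) \<longleftrightarrow> v \<in> S"
    if "z \<in> ?Z" "S \<subseteq> V - {v0}" "v \<in> V - {v0}" for z S v
    using odd_degree_sym_diff[OF fs[OF ZE] fs[OF r(1)], of z S ends v] r(2)[of S v] that
    by (simp add: even_edge_sets_def)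
  \<comment> \<open>The parities of the sum recover \<open>S\<close>, and then cancelling
    \<open>r S\<close> recovers \<open>z\<close>.\<close>
  have "inj_on ?f (?Z \<times> Pow (V - {v0}))"
  proof (rule inj_onI, clarify)
    fix z S z' S'
    assume *: "z \<in> ?Z" "S \<subseteq> V - {v0}" "z' \<in> ?Z" "S' \<subseteq> V - {v0}" "sym_diff z (r S) = sym_diff z' (r S')"
    then have "v \<in> S \<longleftrightarrow> v \<in> S'" if "v \<in> V - {v0}" for v
      using odd[of z S v] odd[of z' S' v] that by simp
    then have "S = S'" using *(2,4) by blast
    moreover have "z = z'" using *(5) \<open>S = S'\<close> by blast
    ultimately show "z = z' \<and> S = S'" by simp
  qed
  moreover have "?f ` (?Z \<times> Pow (V - {v0})) \<subseteq> Pow E"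
  proof (rule image_subsetI)
    fix p assume "p \<in> ?Z \<times> Pow (V - {v0})"
    then obtain z S where p: "p = (z, S)" "z \<in> ?Z" "S \<subseteq> V - {v0}" by blast
    have "z \<subseteq> E" "r S \<subseteq> E" using ZE r(1) p(2,3) by auto
    then show "?f p \<in> Pow E" unfolding p(1) by blast
  qed
  ultimately have "card (?Z \<times> Pow (V - {v0})) \<le> card (Pow E)"
    using fin(2) by (intro card_inj_on_le[of ?f]) simp_all
  then show ?thesis using fin v0 by (simp add: card_cartesian_product card_Pow)
qed

subsection \<open>Four-regular rotation systems\<close>

locale four_regular_rotation =
  fixes V :: "'v set" and E :: "'e set" and ends :: "'e \<Rightarrow> 'v \<times> 'v"
    and \<sigma> :: "'e \<times> bool \<Rightarrow> 'e \<times> bool"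
  assumes graph: "multigraph V E ends" and regular: "four_regular V E ends"
    and connected: "connected_on E ends V" and rotation: "rotation_system V E ends \<sigma>"
begin

lemma finite_V: "finite V" and finite_E: "finite E" and finite_darts: "finite (darts E)"
  using graph by (auto simp: multigraph_def darts_def)

lemma dvert_in_V: "d \<in> darts E \<Longrightarrow> dvert ends d \<in> V"
  using graph by (auto simp: multigraph_def darts_def dvert_def)

lemma vertex_darts:
  assumes "d \<in> darts E"
  shows "distinct [d, \<sigma> d, \<sigma> (\<sigma> d), \<sigma> (\<sigma> (\<sigma> d))]"
    and "\<sigma> (\<sigma> (\<sigma> (\<sigma> d))) = d"
    and "{d' \<in> darts E. dvert ends d' = dvert ends d} = {d, \<sigma> d, \<sigma> (\<sigma> d), \<sigma> (\<sigma> (\<sigma> d))}"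
proof -
  have bij: "bij_betw \<sigma> (darts E) (darts E)" using rotation by (simp add: rotation_system_def)
  have orb: "forward_orbit \<sigma> d = {d' \<in> darts E. dvert ends d' = dvert ends d}"
    using rotation assms by (simp add: rotation_system_def)
  then have card: "card (forward_orbit \<sigma> d) = 4"
    using regular dvert_in_V[OF assms] by (simp add: four_regular_def)
  note orbit_of_card_four[OF bij assms card]
  then show "distinct [d, \<sigma> d, \<sigma> (\<sigma> d), \<sigma> (\<sigma> (\<sigma> d))]" "\<sigma> (\<sigma> (\<sigma> (\<sigma> d))) = d"
    "{d' \<in> darts E. dvert ends d' = dvert ends d} = {d, \<sigma> d, \<sigma> (\<sigma> d), \<sigma> (\<sigma> (\<sigma> d))}"
    unfolding orb by blast+
qed

lemma rot_in_darts [simp]: "d \<in> darts E \<Longrightarrow> \<sigma> d \<in> darts E"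
  and dvert_rot [simp]: "d \<in> darts E \<Longrightarrow> dvert ends (\<sigma> d) = dvert ends d"
  using vertex_darts(3) by blast+

lemma dart_at:
  assumes "v \<in> V"
  obtains d where "d \<in> darts E" "dvert ends d = v"
proof -
  have "card {d \<in> darts E. dvert ends d = v} = 4" using assms regular by (simp add: four_regular_def)
  then have "{d \<in> darts E. dvert ends d = v} \<noteq> {}" by (metis card.empty zero_neq_numeral)
  then show thesis using that by blast
qed

text \<open>Connectedness in terms of edge-ends: \<open>\<sigma>\<close> runs through all ends at a
  vertex and \<open>opp\<close> crosses an edge, so together they reach every dart from
  \<open>d0\<close>.\<close>

lemma dart_induct [consumes 2, case_names start opp rot]:
  assumes d: "d \<in> darts E" and d0: "d0 \<in> darts E" and start: "P d0"
    and opp: "\<And>d. d \<in> darts E \<Longrightarrow> P d \<Longrightarrow> P (opp d)"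
    and rot: "\<And>d. d \<in> darts E \<Longrightarrow> P d \<Longrightarrow> P (\<sigma> d)"
  shows "P d"
proof -
  have vert: "P d'" if "d \<in> darts E" "P d" "d' \<in> darts E" "dvert ends d' = dvert ends d" for d d'
  proof -
    have "d' \<in> {d, \<sigma> d, \<sigma> (\<sigma> d), \<sigma> (\<sigma> (\<sigma> d))}" using vertex_darts(3)[OF that(1)] that by blast
    moreover have "P (\<sigma> d)" using rot that(1,2) .
    moreover from this have "P (\<sigma> (\<sigma> d))" using rot that(1) by simp
    moreover from this have "P (\<sigma> (\<sigma> (\<sigma> d)))" using rot that(1) by simp
    ultimately show ?thesis using that(2) by blast
  qed
  have "(dvert ends d0, dvert ends d) \<in> (adj_in E ends V)\<^sup>*"
    using connected dvert_in_V d d0 by (simp add: connected_on_def)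
  then have "\<forall>d\<in>darts E. dvert ends d = v \<longrightarrow> P d" if "v = dvert ends d" for v
    unfolding that[symmetric]
  proof (induction rule: rtrancl_induct)
    case base
    then show ?case using vert[OF d0 start] by blast
  next
    case (step u w)
    then obtain e where e: "e \<in> E" "ends e = (u, w) \<or> ends e = (w, u)" by (auto simp: adj_in_def)
    then obtain b where b: "dvert ends (e, b) = u" "dvert ends (opp (e, b)) = w"
      using that[of True] that[of False] by (auto simp: dvert_def opp_def)
    have eb: "(e, b) \<in> darts E" using e by (simp add: darts_def)
    then have "P (opp (e, b))" using step.IH b(1) opp by blast
    then show ?case using vert[of "opp (e, b)"] eb b(2) by auto
  qed
  then show ?thesis using d by blast
qed

text \<open>With the four ends at a vertex listed by \<open>\<sigma>\<close>, evenness becomes a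
  propositional condition on four memberships. Every vertex carries a dart, so quantifying over
  darts covers all vertices.\<close>

lemma even_edge_sets_iff:
  "z \<in> even_edge_sets V E ends \<longleftrightarrow> z \<subseteq> E \<and> (\<forall>d\<in>darts E.
     (fst d \<in> z \<longleftrightarrow> fst (\<sigma> d) \<notin> z) \<longleftrightarrow> (fst (\<sigma> (\<sigma> d)) \<in> z \<longleftrightarrow> fst (\<sigma> (\<sigma> (\<sigma> d))) \<notin> z))"
proof -
  have "even (degree_in ends z (dvert ends d)) \<longleftrightarrow>
     ((fst d \<in> z \<longleftrightarrow> fst (\<sigma> d) \<notin> z) \<longleftrightarrow> (fst (\<sigma> (\<sigma> d)) \<in> z \<longleftrightarrow> fst (\<sigma> (\<sigma> (\<sigma> d))) \<notin> z))"
    if "z \<subseteq> E" "d \<in> darts E" for d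
  proof -
    have "{x \<in> darts z. dvert ends x = dvert ends d} =
        {x \<in> {x \<in> darts E. dvert ends x = dvert ends d}. fst x \<in> z}"
      using that(1) by (auto simp: darts_def)
    then have "degree_in ends z (dvert ends d) =
        card {x \<in> {d, \<sigma> d, \<sigma> (\<sigma> d), \<sigma> (\<sigma> (\<sigma> d))}. fst x \<in> z}"
      unfolding degree_in_def vertex_darts(3)[OF that(2)] by simp
    moreover have "even (card {x \<in> {d, \<sigma> d, \<sigma> (\<sigma> d), \<sigma> (\<sigma> (\<sigma> d))}. fst x \<in> z}) \<longleftrightarrow>
        (((fst d \<in> z) \<noteq> (fst (\<sigma> d) \<in> z)) \<longleftrightarrow> ((fst (\<sigma> (\<sigma> d)) \<in> z) \<noteq> (fst (\<sigma> (\<sigma> (\<sigma> d))) \<in> z)))"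
      using vertex_darts(1)[OF that(2)] by (intro even_card_four) auto
    ultimately show ?thesis by simp
  qed
  moreover have "(\<forall>v\<in>V. Q v) \<longleftrightarrow> (\<forall>d\<in>darts E. Q (dvert ends d))" for Q
    using dart_at dvert_in_V by metis
  ultimately show ?thesis unfolding even_edge_sets_def by auto
qed

section \<open>Face colourings and their coboundaries\<close>

definition coboundary :: "('e \<times> bool) set \<Rightarrow> 'e set" where
  "coboundary \<chi> = {e \<in> E. ((e, True) \<in> \<chi>) \<noteq> ((e, False) \<in> \<chi>)}"

text \<open>Invariance under \<open>\<sigma> \<circ> opp\<close>, read at \<open>opp d\<close>. A
  dart \<open>d\<close> also names the corner between its predecessor under \<open>\<sigma>\<close>
  and \<open>d\<close> itself, so such a set colours corners face by face.\<close>

definition face_closed :: "('e \<times> bool) set \<Rightarrow> bool" where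
  "face_closed \<chi> \<longleftrightarrow> (\<forall>d\<in>darts E. \<sigma> d \<in> \<chi> \<longleftrightarrow> opp d \<in> \<chi>)"

lemma in_coboundary_iff:
  assumes "d \<in> darts E"
  shows "fst d \<in> coboundary \<chi> \<longleftrightarrow> (d \<in> \<chi>) \<noteq> (opp d \<in> \<chi>)"
  using assms by (cases d; cases "snd d") (auto simp: coboundary_def darts_def opp_def)

text \<open>The edge of \<open>d\<close> lies between the corners \<open>d\<close> and
  \<open>\<sigma> d\<close>, so a coboundary can be read off around a single vertex.\<close>

lemma in_coboundary_face_closed_iff:
  assumes "face_closed \<chi>" "d \<in> darts E"
  shows "fst d \<in> coboundary \<chi> \<longleftrightarrow> (d \<in> \<chi>) \<noteq> (\<sigma> d \<in> \<chi>)"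
  using assms in_coboundary_iff by (simp add: face_closed_def)

text \<open>Around a vertex the corner colours telescope: each corner is counted by the two ends
  beside it, and \<open>\<sigma>\<close> closes up after four steps.\<close>

lemma coboundary_even:
  assumes "face_closed \<chi>"
  shows "coboundary \<chi> \<in> even_edge_sets V E ends"
  unfolding even_edge_sets_iff
proof (intro conjI ballI)
  fix d assume d: "d \<in> darts E"
  show "(fst d \<in> coboundary \<chi> \<longleftrightarrow> fst (\<sigma> d) \<notin> coboundary \<chi>) \<longleftrightarrow>
    (fst (\<sigma> (\<sigma> d)) \<in> coboundary \<chi> \<longleftrightarrow> fst (\<sigma> (\<sigma> (\<sigma> d))) \<notin> coboundary \<chi>)"
    using d by (simp add: in_coboundary_face_closed_iff[OF assms] vertex_darts(2)) argo
qed (simp add: coboundary_def subset_iff)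

lemma face_closed_Int: "face_closed \<chi> \<Longrightarrow> face_closed \<kappa> \<Longrightarrow> face_closed (\<chi> \<inter> \<kappa>)"
  by (simp add: face_closed_def)

lemma face_perm: "bij_betw (\<sigma> \<circ> opp) (darts E) (darts E)"
proof -
  have "bij_betw opp (darts E) (darts E)" by (rule bij_betw_byWitness[of _ opp]) auto
  moreover have "bij_betw \<sigma> (darts E) (darts E)" using rotation by (simp add: rotation_system_def)
  ultimately show ?thesis by (rule bij_betw_trans)
qed

lemma faces_subset: "f \<in> faces E \<sigma> \<Longrightarrow> f \<subseteq> darts E"
  using funpow_in[OF face_perm] by (auto simp: faces_def)

lemma face_eq:
  assumes "f \<in> faces E \<sigma>" "d \<in> f"
  shows "f = forward_orbit (\<sigma> \<circ> opp) d"
  using assms forward_orbit_eq[OF finite_darts face_perm] unfolding faces_def by blast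

lemma faces_disjoint:
  assumes "f \<in> faces E \<sigma>" "g \<in> faces E \<sigma>" "d \<in> f" "d \<in> g"
  shows "f = g"
  using face_eq assms by metis

lemma faces_nonempty: "f \<in> faces E \<sigma> \<Longrightarrow> f \<noteq> {}"
  by (auto simp: faces_def)

lemma face_step:
  assumes f: "f \<in> faces E \<sigma>" and d: "d \<in> darts E"
  shows "\<sigma> d \<in> f \<longleftrightarrow> opp d \<in> f"
proof
  assume "opp d \<in> f"
  then have "f = forward_orbit (\<sigma> \<circ> opp) (opp d)" using face_eq[OF f] by simp
  moreover have "((\<sigma> \<circ> opp) ^^ 1) (opp d) \<in> forward_orbit (\<sigma> \<circ> opp) (opp d)" by blast
  ultimately show "\<sigma> d \<in> f" by simp
next
  assume *: "\<sigma> d \<in> f"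
  \<comment> \<open>The face of \<open>opp d\<close> has \<open>\<sigma> d\<close> as its next dart,
    and disjointness of faces identifies it with \<open>f\<close>.\<close>
  define g where "g = forward_orbit (\<sigma> \<circ> opp) (opp d)"
  have "((\<sigma> \<circ> opp) ^^ 1) (opp d) \<in> g" "((\<sigma> \<circ> opp) ^^ 0) (opp d) \<in> g" unfolding g_def by blast+
  then have "\<sigma> d \<in> g" "opp d \<in> g" by simp_all
  moreover have "g \<in> faces E \<sigma>" unfolding g_def faces_def using d by simp
  ultimately show "opp d \<in> f" using faces_disjoint f * by blast
qed

lemma face_closed_Union: "F \<subseteq> faces E \<sigma> \<Longrightarrow> face_closed (\<Union>F)"
  using face_step unfolding face_closed_def by blast

lemma Union_faces_eqD:
  assumes "F \<subseteq> faces E \<sigma>" "G \<subseteq> faces E \<sigma>" "\<Union>F = \<Union>G"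
  shows "F \<subseteq> G"
proof
  fix f assume f: "f \<in> F"
  then obtain d where d: "d \<in> f" using faces_nonempty assms(1) by blast
  then obtain g where "g \<in> G" "d \<in> g" using f assms(3) by blast
  then show "f \<in> G" using faces_disjoint[of f g d] f d assms(1,2) by auto
qed

text \<open>The coboundary determines how a colouring changes across each edge and around each
  vertex, so connectedness leaves only the colour of \<open>d0\<close> free.\<close>

lemma coboundary_eqD:
  assumes "d0 \<in> darts E" "face_closed \<chi>" "face_closed \<psi>" "\<chi> \<subseteq> darts E" "\<psi> \<subseteq> darts E"
    and "d0 \<in> \<chi> \<longleftrightarrow> d0 \<in> \<psi>" "coboundary \<chi> = coboundary \<psi>"
  shows "\<chi> = \<psi>"
proof -
  have "d \<in> \<chi> \<longleftrightarrow> d \<in> \<psi>" if "d \<in> darts E" for d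
    using that assms(1)
  proof (induction rule: dart_induct)
    case start
    show ?case by (rule assms(6))
  next
    case (opp d)
    have "(d \<in> \<chi>) \<noteq> (opp d \<in> \<chi>) \<longleftrightarrow> (d \<in> \<psi>) \<noteq> (opp d \<in> \<psi>)"
      unfolding in_coboundary_iff[OF opp(1), symmetric] assms(7) ..
    then show ?case using opp by blast
  next
    case (rot d)
    have "(d \<in> \<chi>) \<noteq> (\<sigma> d \<in> \<chi>) \<longleftrightarrow> (d \<in> \<psi>) \<noteq> (\<sigma> d \<in> \<psi>)"
      using in_coboundary_face_closed_iff[OF assms(2) rot(1)] in_coboundary_face_closed_iff[OF assms(3) rot(1)]
        assms(7) by simp
    then show ?case using rot by blast
  qed
  then show ?thesis using assms(4,5) by blast
qed

end

section \<open>Consequences of Euler's formula\<close>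

locale four_regular_plane = four_regular_rotation +
  assumes euler: "int (card V) - int (card E) + int (card (faces E \<sigma>)) = 2" and V_nonempty: "V \<noteq> {}"
begin

text \<open>A dimension count, and the place where planarity enters. Coboundaries of face colourings
  have dimension at least |F| - 1, the cycle space has dimension at most |E| - |V| + 1, and Euler's
  formula makes these numbers equal.\<close>

lemma even_edge_set_coboundary:
  assumes "z \<in> even_edge_sets V E ends"
  obtains \<chi> where "face_closed \<chi>" "coboundary \<chi> = z"
proof -
  obtain v0 where v0: "v0 \<in> V" using V_nonempty by blast
  obtain d0 where d0: "d0 \<in> darts E" using dart_at[OF v0] .
  let ?Z = "even_edge_sets V E ends"
  let ?B = "(\<lambda>F. coboundary (\<Union>F)) ` Pow (faces E \<sigma>)"
  have BZ: "?B \<subseteq> ?Z" using coboundary_even face_closed_Union by blast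
  have finZ: "finite ?Z"
    using finite_E by (intro finite_subset[of ?Z "Pow E"]) (auto simp: even_edge_sets_def)
  have finF: "finite (faces E \<sigma>)" unfolding faces_def using finite_darts by simp
  \<comment> \<open>A colouring and its complement have the same coboundary; the bit at
    \<open>d0\<close> tells them apart and accounts for the factor 2 below.\<close>
  have "inj_on (\<lambda>F. (d0 \<in> \<Union>F, coboundary (\<Union>F))) (Pow (faces E \<sigma>))"
  proof (rule inj_onI)
    fix F G assume *: "F \<in> Pow (faces E \<sigma>)" "G \<in> Pow (faces E \<sigma>)"
      "(d0 \<in> \<Union>F, coboundary (\<Union>F)) = (d0 \<in> \<Union>G, coboundary (\<Union>G))"
    then have FG: "F \<subseteq> faces E \<sigma>" "G \<subseteq> faces E \<sigma>"
      "d0 \<in> \<Union>F \<longleftrightarrow> d0 \<in> \<Union>G" "coboundary (\<Union>F) = coboundary (\<Union>G)" by simp_all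
    then have sub: "\<Union>F \<subseteq> darts E" "\<Union>G \<subseteq> darts E" using faces_subset by blast+
    have "\<Union>F = \<Union>G"
      by (rule coboundary_eqD[OF d0 face_closed_Union face_closed_Union sub FG(3,4)]) fact+
    then show "F = G" using Union_faces_eqD FG(1,2) by (metis subset_antisym)
  qed
  then have "card (Pow (faces E \<sigma>)) \<le> card ((UNIV :: bool set) \<times> ?B)"
    using finF by (intro card_inj_on_le[of "\<lambda>F. (d0 \<in> \<Union>F, coboundary (\<Union>F))"]) auto
  then have B: "2 ^ card (faces E \<sigma>) \<le> 2 * card ?B"
    using finF by (simp add: card_Pow card_cartesian_product)
  have Z: "card ?Z * 2 ^ (card V - 1) \<le> 2 ^ card E"
    using card_even_edge_sets_le[OF graph connected v0] .
  obtain n where n: "card V = Suc n"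
    using v0 finite_V by (metis card_gt_0_iff empty_iff gr0_implies_Suc)
  have e: "card E + 1 = n + card (faces E \<sigma>)" using euler n by simp
  have "(2 * card ?Z) * 2 ^ n \<le> 2 ^ (card E + 1)" using Z n by simp
  also have "\<dots> = 2 ^ card (faces E \<sigma>) * 2 ^ n" unfolding e by (simp add: power_add)
  finally have "2 * card ?Z \<le> 2 ^ card (faces E \<sigma>)" by simp
  with B have "card ?Z \<le> card ?B" by simp
  then have "?B = ?Z" using BZ finZ by (simp add: card_seteq)
  with assms have "z \<in> ?B" by simp
  then obtain F where "F \<subseteq> faces E \<sigma>" "z = coboundary (\<Union>F)" by blast
  then show thesis using that[of "\<Union>F"] face_closed_Union[of F] by simp
qed

text \<open>
  \<kappa> is the set of corners lying in black faces. Only the differences of w at consecutive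
  edge-ends are described, since w is determined up to a constant at each vertex.
\<close>
lemma local_projection:
  obtains \<kappa> where "\<And>d. d \<in> darts E \<Longrightarrow> \<sigma> d \<in> \<kappa> \<longleftrightarrow> d \<notin> \<kappa>"
    and "\<And>z. z \<in> even_edge_sets V E ends \<Longrightarrow> \<exists>w\<in>even_edge_sets V E ends. \<forall>d\<in>darts E.
      (fst d \<in> w) \<noteq> (fst (\<sigma> d) \<in> w) \<longleftrightarrow> d \<in> \<kappa> \<and> (fst d \<in> z) \<noteq> (fst (\<sigma> d) \<in> z)"
proof -
  have E: "fst d \<in> E" if "d \<in> darts E" for d using that by (auto simp: darts_def)
  \<comment> \<open>All degrees are four, so \<open>E\<close> is even; a colouring with coboundary
    \<open>E\<close> takes different values on the two sides of every edge.\<close>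
  have "E \<in> even_edge_sets V E ends" unfolding even_edge_sets_iff by (simp add: E)
  then obtain \<kappa> where \<kappa>: "face_closed \<kappa>" "coboundary \<kappa> = E" by (rule even_edge_set_coboundary)
  have alt: "\<sigma> d \<in> \<kappa> \<longleftrightarrow> d \<notin> \<kappa>" if "d \<in> darts E" for d
    using in_coboundary_face_closed_iff[OF \<kappa>(1) that] E[OF that] \<kappa>(2) by blast
  have "\<exists>w\<in>even_edge_sets V E ends. \<forall>d\<in>darts E.
      (fst d \<in> w) \<noteq> (fst (\<sigma> d) \<in> w) \<longleftrightarrow> d \<in> \<kappa> \<and> (fst d \<in> z) \<noteq> (fst (\<sigma> d) \<in> z)"
    if z: "z \<in> even_edge_sets V E ends" for z
  proof -
    obtain \<chi> where \<chi>: "face_closed \<chi>" "coboundary \<chi> = z" using even_edge_set_coboundary[OF z] .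
    have c: "face_closed (\<kappa> \<inter> \<chi>)" using \<kappa> \<chi> face_closed_Int by blast
    \<comment> \<open>The corner \<open>\<sigma> d\<close> cancels, leaving the colours of
      \<open>\<kappa> \<inter> \<chi>\<close> at the corners \<open>d\<close> and
      \<open>\<sigma> (\<sigma> d)\<close>. These two agree in \<open>\<kappa>\<close>, which
      therefore factors out.\<close>
    have "(fst d \<in> coboundary (\<kappa> \<inter> \<chi>)) \<noteq> (fst (\<sigma> d) \<in> coboundary (\<kappa> \<inter> \<chi>)) \<longleftrightarrow>
        d \<in> \<kappa> \<and> (fst d \<in> z) \<noteq> (fst (\<sigma> d) \<in> z)" if d: "d \<in> darts E" for d
      using alt[OF d] alt[of "\<sigma> d"] d unfolding \<chi>(2)[symmetric]
      by (simp add: in_coboundary_face_closed_iff[OF c] in_coboundary_face_closed_iff[OF \<chi>(1)]) blast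
    then show ?thesis using coboundary_even[OF c] by blast
  qed
  then show thesis using that alt by blast
qed

end

subsection \<open>Unions of threaded circuits\<close>

text \<open>The space R in local form: it mentions no circuits and can be studied vertex by
  vertex.\<close>

definition straight_edge_sets :: "'e set \<Rightarrow> ('e \<times> bool \<Rightarrow> 'e \<times> bool) \<Rightarrow> 'e set set" where
  "straight_edge_sets E \<sigma> = {z. z \<subseteq> E \<and> (\<forall>d\<in>darts E. fst d \<in> z \<longleftrightarrow> fst (\<sigma> (\<sigma> d)) \<in> z)}"

context four_regular_rotation
begin

lemma straight_even: "straight_edge_sets E \<sigma> \<subseteq> even_edge_sets V E ends"
proof
  fix z assume z: "z \<in> straight_edge_sets E \<sigma>"
  have "fst (\<sigma> (\<sigma> d)) \<in> z \<longleftrightarrow> fst d \<in> z" if "d \<in> darts E" for d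
    using z that by (simp add: straight_edge_sets_def)
  then show "z \<in> even_edge_sets V E ends"
    using z unfolding even_edge_sets_iff by (simp add: straight_edge_sets_def)
qed

text \<open>Four applications of \<open>\<sigma>\<close> give the identity, so the two alternatives
  in \<open>is_thread\<close> coincide.\<close>

lemma is_threadD:
  assumes "is_thread \<sigma> h h'" "h \<in> darts E" "h' \<in> darts E"
  shows "h' = \<sigma> (\<sigma> h)" "h = \<sigma> (\<sigma> h')"
  using assms vertex_darts(2)[OF assms(2)] vertex_darts(2)[OF assms(3)] unfolding is_thread_def by auto

text \<open>Membership in \<open>z\<close> passes through each thread to the next edge, and so all
  the way round. Together with \<open>circuit_straight\<close> this makes the circuits atoms of
  R.\<close>

lemma circuit_subset_straight:
  assumes c: "threaded_circuit E ends \<sigma> ds" and z: "z \<in> straight_edge_sets E \<sigma>"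
    and meet: "fst ` set ds \<inter> z \<noteq> {}"
  shows "fst ` set ds \<subseteq> z"
proof -
  let ?n = "length ds"
  have nth: "ds ! i \<in> darts E" if "i < ?n" for i
    using c nth_mem[OF that] by (auto simp: threaded_circuit_def)
  have step: "fst (ds ! i) \<in> z \<longleftrightarrow> fst (ds ! ((i + 1) mod ?n)) \<in> z" if i: "i < ?n" for i
  proof -
    have j: "(i + 1) mod ?n < ?n" using i by (intro mod_less_divisor) linarith
    have "is_thread \<sigma> (opp (ds ! i)) (ds ! ((i + 1) mod ?n))" using c i by (simp add: threaded_circuit_def)
    from is_threadD(1)[OF this] have "ds ! ((i + 1) mod ?n) = \<sigma> (\<sigma> (opp (ds ! i)))" using nth i j by simp
    moreover have "fst (opp (ds ! i)) \<in> z \<longleftrightarrow> fst (\<sigma> (\<sigma> (opp (ds ! i)))) \<in> z"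
      using z nth[OF i] by (simp add: straight_edge_sets_def del: fst_opp)
    ultimately show ?thesis by simp
  qed
  have const: "fst (ds ! i) \<in> z \<longleftrightarrow> fst (ds ! 0) \<in> z" if "i < ?n" for i
    using that
  proof (induction i)
    case (Suc i)
    then show ?case using step[of i] by simp
  qed simp
  have set_ds: "set ds = (!) ds ` {..<?n}" by (auto simp: set_conv_nth)
  obtain i where "i < ?n" "fst (ds ! i) \<in> z" using meet unfolding set_ds by blast
  then have "fst (ds ! 0) \<in> z" using const by blast
  then show ?thesis using const unfolding set_ds by blast
qed

lemma circuit_straight:
  assumes c: "threaded_circuit E ends \<sigma> ds"
  shows "fst ` set ds \<in> straight_edge_sets E \<sigma>"
proof -
  let ?n = "length ds" and ?S = "fst ` set ds"
  have nth: "ds ! i \<in> darts E" if "i < ?n" for i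
    using c nth_mem[OF that] by (auto simp: threaded_circuit_def)
  have thread: "ds ! ((i + 1) mod ?n) = \<sigma> (\<sigma> (opp (ds ! i)))" "opp (ds ! i) = \<sigma> (\<sigma> (ds ! ((i + 1) mod ?n)))"
    if i: "i < ?n" for i
  proof -
    have j: "(i + 1) mod ?n < ?n" using i by (intro mod_less_divisor) linarith
    have "is_thread \<sigma> (opp (ds ! i)) (ds ! ((i + 1) mod ?n))" using c i by (simp add: threaded_circuit_def)
    from is_threadD[OF this] show "ds ! ((i + 1) mod ?n) = \<sigma> (\<sigma> (opp (ds ! i)))"
      "opp (ds ! i) = \<sigma> (\<sigma> (ds ! ((i + 1) mod ?n)))" using nth[OF i] nth[OF j] by simp_all
  qed
  have S: "fst (ds ! i) \<in> ?S" if "i < ?n" for i using that by simp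
  have closed: "fst (\<sigma> (\<sigma> d)) \<in> ?S" if d: "d \<in> darts E" "fst d \<in> ?S" for d
  proof -
    obtain i where i: "i < ?n" "fst d = fst (ds ! i)" using d(2) by (auto simp: in_set_conv_nth)
    \<comment> \<open>At the far end of the edge the next edge of the circuit continues it; at the
      near end the previous one does.\<close>
    have "d = ds ! i \<or> d = opp (ds ! i)" using i(2) by (cases d; cases "ds ! i") (auto simp: opp_def)
    then show ?thesis
    proof
      assume "d = opp (ds ! i)"
      then have "\<sigma> (\<sigma> d) = ds ! ((i + 1) mod ?n)" using thread(1)[OF i(1)] by simp
      moreover have "(i + 1) mod ?n < ?n" using i(1) by (intro mod_less_divisor) linarith
      ultimately show ?thesis using S by metis
    next
      assume d: "d = ds ! i"
      \<comment> \<open>The cyclic predecessor of \<open>i\<close>; adding \<open>?n - 1\<close>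
        instead of subtracting 1 also covers \<open>i = 0\<close>.\<close>
      define j where "j = (i + (?n - 1)) mod ?n"
      have "j < ?n" using i(1) unfolding j_def by (intro mod_less_divisor) linarith
      have "(j + 1) mod ?n = (i + (?n - 1) + 1) mod ?n" unfolding j_def by (rule mod_add_left_eq)
      also have "i + (?n - 1) + 1 = i + ?n" using i(1) by linarith
      also have "(i + ?n) mod ?n = i" using i(1) by simp
      finally have "\<sigma> (\<sigma> d) = opp (ds ! j)" using thread(2)[OF \<open>j < ?n\<close>] d by simp
      then show ?thesis using S[OF \<open>j < ?n\<close>] by simp
    qed
  qed
  have "fst d \<in> ?S \<longleftrightarrow> fst (\<sigma> (\<sigma> d)) \<in> ?S" if d: "d \<in> darts E" for d
    using closed[OF d] closed[of "\<sigma> (\<sigma> d)"] d vertex_darts(2)[OF d] by auto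
  moreover have "?S \<subseteq> E" using c by (auto simp: threaded_circuit_def darts_def)
  ultimately show ?thesis unfolding straight_edge_sets_def by blast
qed

text \<open>A straight set is the union of the circuits that it meets, and this choice of circuits
  is unique because circuits are disjoint and nonempty.\<close>

lemma card_straight_edge_sets:
  assumes "threaded_circuit_partition E ends \<sigma> P"
  shows "card (straight_edge_sets E \<sigma>) = 2 ^ card P"
proof -
  have circ: "\<exists>ds. threaded_circuit E ends \<sigma> ds \<and> S = fst ` set ds" if "S \<in> P" for S
    using assms that by (simp add: threaded_circuit_partition_def)
  have disj: "S = S'" if "S \<in> P" "S' \<in> P" "e \<in> S" "e \<in> S'" for S S' e
    using assms that unfolding threaded_circuit_partition_def by blast
  have cover: "\<Union>P = E" using assms by (simp add: threaded_circuit_partition_def)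
  have ne: "S \<noteq> {}" if "S \<in> P" for S using circ[OF that] by (auto simp: threaded_circuit_def)
  have "finite P" using cover finite_E by (simp add: finite_UnionD)
  have union: "\<Union>F \<in> straight_edge_sets E \<sigma>" if "F \<subseteq> P" for F
  proof -
    have "S \<in> straight_edge_sets E \<sigma>" if "S \<in> F" for S
      using circ[of S] circuit_straight that \<open>F \<subseteq> P\<close> by blast
    then show ?thesis unfolding straight_edge_sets_def by blast
  qed
  have "bij_betw Union (Pow P) (straight_edge_sets E \<sigma>)"
  proof (intro bij_betw_imageI subset_antisym)
    have "F \<subseteq> G" if FG: "F \<subseteq> P" "G \<subseteq> P" "\<Union>F = \<Union>G" for F G
    proof
      fix S assume S: "S \<in> F"
      then obtain e where e: "e \<in> S" using ne[of S] FG(1) by blast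
      then obtain S' where S': "S' \<in> G" "e \<in> S'" using S FG(3) by blast
      then show "S \<in> G" using disj[OF _ _ e S'(2)] S S'(1) FG(1,2) by blast
    qed
    then show "inj_on Union (Pow P)" unfolding inj_on_def by (metis PowD subset_antisym)
    show "Union ` Pow P \<subseteq> straight_edge_sets E \<sigma>" using union by blast
    show "straight_edge_sets E \<sigma> \<subseteq> Union ` Pow P"
    proof
      fix z assume z: "z \<in> straight_edge_sets E \<sigma>"
      have "S \<subseteq> z" if "S \<in> P" "S \<inter> z \<noteq> {}" for S
        using circ[OF that(1)] circuit_subset_straight[OF _ z] that(2) by blast
      moreover have "z \<subseteq> \<Union>P" using z cover by (simp add: straight_edge_sets_def)
      ultimately have "z = \<Union>{S \<in> P. S \<inter> z \<noteq> {}}" by blast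
      then show "z \<in> Union ` Pow P" by blast
    qed
  qed
  from bij_betw_same_card[OF this] show ?thesis using card_Pow[OF \<open>finite P\<close>] by simp
qed

end

subsection \<open>Comparing two embeddings\<close>

text \<open>
  Here w1 = e z, w2 = e' z, s = e z + e' z, w3 = e s and w4 = e' s at a single vertex with
  edge-ends X.
\<close>
lemma local_transfer:
  fixes \<sigma> \<sigma>' :: "'a \<Rightarrow> 'a" and k k' z w1 w2 s w3 w4 g :: "'a \<Rightarrow> bool"
  assumes X: "X = {d, \<sigma> d, \<sigma> (\<sigma> d), \<sigma> (\<sigma> (\<sigma> d))}"
    and X': "X = {d, \<sigma>' d, \<sigma>' (\<sigma>' d), \<sigma>' (\<sigma>' (\<sigma>' d))}"
    and dist: "distinct [d, \<sigma>' d, \<sigma>' (\<sigma>' d), \<sigma>' (\<sigma>' (\<sigma>' d))]"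
    and k: "\<And>x. x \<in> X \<Longrightarrow> k (\<sigma> x) \<longleftrightarrow> \<not> k x" and k': "\<And>x. x \<in> X \<Longrightarrow> k' (\<sigma>' x) \<longleftrightarrow> \<not> k' x"
    and z: "\<And>x. x \<in> X \<Longrightarrow> z x \<longleftrightarrow> z (\<sigma> (\<sigma> x))"
    and w1: "\<And>x. x \<in> X \<Longrightarrow> w1 x \<noteq> w1 (\<sigma> x) \<longleftrightarrow> k x \<and> z x \<noteq> z (\<sigma> x)"
    and w2: "\<And>x. x \<in> X \<Longrightarrow> w2 x \<noteq> w2 (\<sigma>' x) \<longleftrightarrow> k' x \<and> z x \<noteq> z (\<sigma>' x)"
    and s: "\<And>x. x \<in> X \<Longrightarrow> s x \<longleftrightarrow> w1 x \<noteq> w2 x"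
    and w3: "\<And>x. x \<in> X \<Longrightarrow> w3 x \<noteq> w3 (\<sigma> x) \<longleftrightarrow> k x \<and> s x \<noteq> s (\<sigma> x)"
    and w4: "\<And>x. x \<in> X \<Longrightarrow> w4 x \<noteq> w4 (\<sigma>' x) \<longleftrightarrow> k' x \<and> s x \<noteq> s (\<sigma>' x)"
    and g: "\<And>x. x \<in> X \<Longrightarrow> g x \<longleftrightarrow> (z x \<noteq> s x) \<noteq> (w3 x \<noteq> w4 x)"
  shows "g d \<longleftrightarrow> g (\<sigma>' (\<sigma>' d))" and "g d \<noteq> g (\<sigma>' d) \<longleftrightarrow> z d \<noteq> z (\<sigma> d)"
proof -
  define a b c where "a = \<sigma> d" and "b = \<sigma> a" and "c = \<sigma> b"
  have sig: "\<sigma> d = a" "\<sigma> a = b" "\<sigma> b = c" by (simp_all add: a_def b_def c_def)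
  have Xs: "X = {d, a, b, c}" using X by (simp add: sig)
  then have mem: "d \<in> X" "a \<in> X" "b \<in> X" "c \<in> X" by auto
  define p q r where "p = \<sigma>' d" and "q = \<sigma>' p" and "r = \<sigma>' q"
  have sig': "\<sigma>' d = p" "\<sigma>' p = q" "\<sigma>' q = r" by (simp_all add: p_def q_def r_def)
  have mem': "p \<in> X" "q \<in> X" "r \<in> X" using X' unfolding sig' by blast+
  moreover have "distinct [d, p, q, r]" using dist by (simp add: sig')
  ultimately have orders: "p = a \<and> q = b \<and> r = c \<or> p = a \<and> q = c \<and> r = b \<or> p = b \<and> q = a \<and> r = c
    \<or> p = b \<and> q = c \<and> r = a \<or> p = c \<and> q = a \<and> r = b \<or> p = c \<and> q = b \<and> r = a"
    unfolding Xs by auto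
  \<comment> \<open>Each difference becomes a rewrite rule giving the value at one end from the
    value at the previous end. Three steps from \<open>d\<close> reach all four ends; the values of
    \<open>w1\<close> to \<open>w4\<close> at \<open>d\<close> stay arbitrary.\<close>
  have xorD: "y \<longleftrightarrow> x \<noteq> P" if "x \<noteq> y \<longleftrightarrow> P" for x y P using that by blast
  note e = z[OF mem(1), symmetric] z[OF mem(2), symmetric] k[OF mem(1)] k[OF mem(2)] k[OF mem(3)]
    w1[OF mem(1), THEN xorD] w1[OF mem(2), THEN xorD] w1[OF mem(3), THEN xorD]
    w3[OF mem(1), THEN xorD] w3[OF mem(2), THEN xorD] w3[OF mem(3), THEN xorD]
  note e = e[unfolded sig] s[OF mem(1)] s[OF mem(2)] s[OF mem(3)] s[OF mem(4)]
    g[OF mem(1)] g[OF mem(2)] g[OF mem(3)] g[OF mem(4)]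
  note e' = k'[OF mem(1)] k'[OF mem'(1)] k'[OF mem'(2)]
    w2[OF mem(1), THEN xorD] w2[OF mem'(1), THEN xorD] w2[OF mem'(2), THEN xorD]
    w4[OF mem(1), THEN xorD] w4[OF mem'(1), THEN xorD] w4[OF mem'(2), THEN xorD]
  note e' = e'[unfolded sig']
  \<comment> \<open>The reason behind the case check: modulo constants, a nonzero even function on
    four ends is one of three pairings, any two of which add up to the third. Let A be the opposite
    pairing and B, C the adjacent ones, with e projecting onto B along C, and A', B', C' likewise
    for e'. If A' = A, then s is 0 or 1 and g = 1. If A' differs from A and B' = B or C' = C, then s
    squares to 0 and g = 1 + s. Otherwise s exchanges A and A', and g = s. Each time g takes A to
    A'.\<close>
  have "(g d \<longleftrightarrow> g q) \<and> (g d \<noteq> g p \<longleftrightarrow> z d \<noteq> z a)"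
    using orders
  proof (elim disjE conjE)
    assume pqr: "p = a" "q = b" "r = c"
    show ?thesis unfolding pqr
      by (cases "k d"; cases "k' d"; cases "z d"; cases "z a"; auto simp: e e'[unfolded pqr])
  next
    assume pqr: "p = a" "q = c" "r = b"
    show ?thesis unfolding pqr
      by (cases "k d"; cases "k' d"; cases "z d"; cases "z a"; auto simp: e e'[unfolded pqr])
  next
    assume pqr: "p = b" "q = a" "r = c"
    show ?thesis unfolding pqr
      by (cases "k d"; cases "k' d"; cases "z d"; cases "z a"; auto simp: e e'[unfolded pqr])
  next
    assume pqr: "p = b" "q = c" "r = a"
    show ?thesis unfolding pqr
      by (cases "k d"; cases "k' d"; cases "z d"; cases "z a"; auto simp: e e'[unfolded pqr])
  next
    assume pqr: "p = c" "q = a" "r = b"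
    show ?thesis unfolding pqr
      by (cases "k d"; cases "k' d"; cases "z d"; cases "z a"; auto simp: e e'[unfolded pqr])
  next
    assume pqr: "p = c" "q = b" "r = a"
    show ?thesis unfolding pqr
      by (cases "k d"; cases "k' d"; cases "z d"; cases "z a"; auto simp: e e'[unfolded pqr])
  qed
  then show "g d \<longleftrightarrow> g (\<sigma>' (\<sigma>' d))" and "g d \<noteq> g (\<sigma>' d) \<longleftrightarrow> z d \<noteq> z (\<sigma> d)" unfolding sig sig' by blast+
qed

text \<open>The clause on differences says that \<open>g\<close> is constant at exactly those
  vertices where \<open>z\<close> is. It is what makes the passage from \<open>z\<close> to
  \<open>g\<close> injective up to complements.\<close>

lemma straight_transfer:
  assumes P: "four_regular_plane V E ends \<sigma>" and Q: "four_regular_plane V E ends \<sigma>'"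
    and z: "z \<in> straight_edge_sets E \<sigma>"
  shows "\<exists>g\<in>straight_edge_sets E \<sigma>'. \<forall>d\<in>darts E.
    (fst d \<in> g) \<noteq> (fst (\<sigma>' d) \<in> g) \<longleftrightarrow> (fst d \<in> z) \<noteq> (fst (\<sigma> d) \<in> z)"
proof -
  interpret P: four_regular_plane V E ends \<sigma> by fact
  interpret Q: four_regular_plane V E ends \<sigma>' by fact
  let ?Z = "even_edge_sets V E ends"
  obtain \<kappa> where \<kappa>: "\<And>d. d \<in> darts E \<Longrightarrow> \<sigma> d \<in> \<kappa> \<longleftrightarrow> d \<notin> \<kappa>"
    and proj: "\<And>z. z \<in> ?Z \<Longrightarrow> \<exists>w\<in>?Z. \<forall>d\<in>darts E.
      (fst d \<in> w) \<noteq> (fst (\<sigma> d) \<in> w) \<longleftrightarrow> d \<in> \<kappa> \<and> (fst d \<in> z) \<noteq> (fst (\<sigma> d) \<in> z)"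
    by (rule P.local_projection) blast
  obtain \<kappa>' where \<kappa>': "\<And>d. d \<in> darts E \<Longrightarrow> \<sigma>' d \<in> \<kappa>' \<longleftrightarrow> d \<notin> \<kappa>'"
    and proj': "\<And>z. z \<in> ?Z \<Longrightarrow> \<exists>w\<in>?Z. \<forall>d\<in>darts E.
      (fst d \<in> w) \<noteq> (fst (\<sigma>' d) \<in> w) \<longleftrightarrow> d \<in> \<kappa>' \<and> (fst d \<in> z) \<noteq> (fst (\<sigma>' d) \<in> z)"
    by (rule Q.local_projection) blast
  have zZ: "z \<in> ?Z" using z P.straight_even by blast
  obtain w1 where w1: "w1 \<in> ?Z" "\<And>d. d \<in> darts E \<Longrightarrow>
      (fst d \<in> w1) \<noteq> (fst (\<sigma> d) \<in> w1) \<longleftrightarrow> d \<in> \<kappa> \<and> (fst d \<in> z) \<noteq> (fst (\<sigma> d) \<in> z)"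
    using proj[OF zZ] by blast
  obtain w2 where w2: "w2 \<in> ?Z" "\<And>d. d \<in> darts E \<Longrightarrow>
      (fst d \<in> w2) \<noteq> (fst (\<sigma>' d) \<in> w2) \<longleftrightarrow> d \<in> \<kappa>' \<and> (fst d \<in> z) \<noteq> (fst (\<sigma>' d) \<in> z)"
    using proj'[OF zZ] by blast
  define s where "s = sym_diff w1 w2"
  have s: "s \<in> ?Z" unfolding s_def by (intro even_edge_sets_sym_diff P.finite_E w1(1) w2(1))
  obtain w3 where w3: "w3 \<in> ?Z" "\<And>d. d \<in> darts E \<Longrightarrow>
      (fst d \<in> w3) \<noteq> (fst (\<sigma> d) \<in> w3) \<longleftrightarrow> d \<in> \<kappa> \<and> (fst d \<in> s) \<noteq> (fst (\<sigma> d) \<in> s)"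
    using proj[OF s] by blast
  obtain w4 where w4: "w4 \<in> ?Z" "\<And>d. d \<in> darts E \<Longrightarrow>
      (fst d \<in> w4) \<noteq> (fst (\<sigma>' d) \<in> w4) \<longleftrightarrow> d \<in> \<kappa>' \<and> (fst d \<in> s) \<noteq> (fst (\<sigma>' d) \<in> s)"
    using proj'[OF s] by blast
  \<comment> \<open>The value of 1 + s + s * s at \<open>z\<close>: the set \<open>s\<close> is the
    image of \<open>z\<close>, and \<open>w3\<close>, \<open>w4\<close> are the two projections of
    that image.\<close>
  define g where "g = sym_diff (sym_diff z s) (sym_diff w3 w4)"
  have "g \<in> ?Z" unfolding g_def
    by (intro even_edge_sets_sym_diff P.finite_E zZ s w3(1) w4(1))
  then have gE: "g \<subseteq> E" by (simp add: even_edge_sets_def)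
  have zs: "fst d \<in> z \<longleftrightarrow> fst (\<sigma> (\<sigma> d)) \<in> z" if "d \<in> darts E" for d
    using z that by (simp add: straight_edge_sets_def)
  have local: "(fst d \<in> g \<longleftrightarrow> fst (\<sigma>' (\<sigma>' d)) \<in> g) \<and>
      ((fst d \<in> g) \<noteq> (fst (\<sigma>' d) \<in> g) \<longleftrightarrow> (fst d \<in> z) \<noteq> (fst (\<sigma> d) \<in> z))"
    if d: "d \<in> darts E" for d
  proof -
    define X where "X = {d' \<in> darts E. dvert ends d' = dvert ends d}"
    have X: "x \<in> darts E" if "x \<in> X" for x using that by (simp add: X_def)
    have sx: "fst x \<in> s \<longleftrightarrow> (fst x \<in> w1) \<noteq> (fst x \<in> w2)" for x :: "'b \<times> bool" unfolding s_def by blast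
    have gx: "fst x \<in> g \<longleftrightarrow> ((fst x \<in> z) \<noteq> (fst x \<in> s)) \<noteq> ((fst x \<in> w3) \<noteq> (fst x \<in> w4))"
      for x :: "'b \<times> bool" unfolding g_def by blast
    note tr = local_transfer[OF P.vertex_darts(3)[OF d, folded X_def]
      Q.vertex_darts(3)[OF d, folded X_def] Q.vertex_darts(1)[OF d],
      of "\<lambda>x. x \<in> \<kappa>" "\<lambda>x. x \<in> \<kappa>'" "\<lambda>x. fst x \<in> z" "\<lambda>x. fst x \<in> w1" "\<lambda>x. fst x \<in> w2"
        "\<lambda>x. fst x \<in> s" "\<lambda>x. fst x \<in> w3" "\<lambda>x. fst x \<in> w4" "\<lambda>x. fst x \<in> g",
      OF \<kappa>[OF X] \<kappa>'[OF X] zs[OF X] w1(2)[OF X] w2(2)[OF X] sx w3(2)[OF X] w4(2)[OF X] gx]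
    show ?thesis by (intro conjI tr)
  qed
  then have "g \<in> straight_edge_sets E \<sigma>'" using gE unfolding straight_edge_sets_def by blast
  then show ?thesis using local by blast
qed

text \<open>The differences of the image determine those of \<open>z\<close>. Once the membership of
  the edge of \<open>d0\<close> is kept as well, connectedness recovers \<open>z\<close>.\<close>

lemma card_straight_le:
  assumes P: "four_regular_plane V E ends \<sigma>" and Q: "four_regular_plane V E ends \<sigma>'"
  shows "card (straight_edge_sets E \<sigma>) \<le> card (straight_edge_sets E \<sigma>')"
proof -
  interpret P: four_regular_plane V E ends \<sigma> by fact
  interpret Q: four_regular_plane V E ends \<sigma>' by fact
  obtain v0 where "v0 \<in> V" using P.V_nonempty by blast
  then obtain d0 where d0: "d0 \<in> darts E" by (rule P.dart_at)
  have fst_E: "fst d \<in> E" if "d \<in> darts E" for d using that by (auto simp: darts_def)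
  have "\<exists>g\<in>straight_edge_sets E \<sigma>'. (fst d0 \<in> g \<longleftrightarrow> fst d0 \<in> z) \<and> (\<forall>d\<in>darts E.
      (fst d \<in> g) \<noteq> (fst (\<sigma>' d) \<in> g) \<longleftrightarrow> (fst d \<in> z) \<noteq> (fst (\<sigma> d) \<in> z))"
    if z: "z \<in> straight_edge_sets E \<sigma>" for z
  proof -
    obtain g where g: "g \<in> straight_edge_sets E \<sigma>'" "\<And>d. d \<in> darts E \<Longrightarrow>
        (fst d \<in> g) \<noteq> (fst (\<sigma>' d) \<in> g) \<longleftrightarrow> (fst d \<in> z) \<noteq> (fst (\<sigma> d) \<in> z)"
      using straight_transfer[OF P Q z] by blast
    show ?thesis
    proof (cases "fst d0 \<in> g \<longleftrightarrow> fst d0 \<in> z")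
      case True
      then show ?thesis using g by blast
    next
      case False
      \<comment> \<open>Complementing g changes none of its differences.\<close>
      have c: "fst d \<in> E - g \<longleftrightarrow> fst d \<notin> g" if "d \<in> darts E" for d using fst_E[OF that] by blast
      have "fst d \<in> E - g \<longleftrightarrow> fst (\<sigma>' (\<sigma>' d)) \<in> E - g" if d: "d \<in> darts E" for d
      proof -
        have "fst d \<in> g \<longleftrightarrow> fst (\<sigma>' (\<sigma>' d)) \<in> g" using g(1) d by (simp add: straight_edge_sets_def)
        then show ?thesis using c[OF d] c[of "\<sigma>' (\<sigma>' d)"] d by simp
      qed
      then have Eg: "E - g \<in> straight_edge_sets E \<sigma>'" unfolding straight_edge_sets_def by blast
      have start: "fst d0 \<in> E - g \<longleftrightarrow> fst d0 \<in> z" using False c[OF d0] by blast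
      have "(fst d \<in> E - g) \<noteq> (fst (\<sigma>' d) \<in> E - g) \<longleftrightarrow> (fst d \<in> z) \<noteq> (fst (\<sigma> d) \<in> z)"
        if "d \<in> darts E" for d
        using g(2)[OF that] c[OF that] c[OF Q.rot_in_darts[OF that]] by blast
      with start show ?thesis by (intro bexI[OF _ Eg] conjI ballI)
    qed
  qed
  then have "\<forall>z\<in>straight_edge_sets E \<sigma>. \<exists>g. g \<in> straight_edge_sets E \<sigma>' \<and>
      (fst d0 \<in> g \<longleftrightarrow> fst d0 \<in> z) \<and> (\<forall>d\<in>darts E.
      (fst d \<in> g) \<noteq> (fst (\<sigma>' d) \<in> g) \<longleftrightarrow> (fst d \<in> z) \<noteq> (fst (\<sigma> d) \<in> z))"
    unfolding Bex_def by (rule ballI)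
  from bchoice[OF this] obtain G where G: "\<forall>z\<in>straight_edge_sets E \<sigma>. G z \<in> straight_edge_sets E \<sigma>' \<and>
      (fst d0 \<in> G z \<longleftrightarrow> fst d0 \<in> z) \<and> (\<forall>d\<in>darts E.
      (fst d \<in> G z) \<noteq> (fst (\<sigma>' d) \<in> G z) \<longleftrightarrow> (fst d \<in> z) \<noteq> (fst (\<sigma> d) \<in> z))" ..
  note G1 = bspec[OF G, THEN conjunct1] and G2 = bspec[OF G, THEN conjunct2, THEN conjunct1]
    and G3 = bspec[OF bspec[OF G, THEN conjunct2, THEN conjunct2]]
  have "inj_on G (straight_edge_sets E \<sigma>)"
  proof (rule inj_onI)
    fix y z assume y: "y \<in> straight_edge_sets E \<sigma>" and z: "z \<in> straight_edge_sets E \<sigma>" and eq: "G y = G z"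
    \<comment> \<open>Crossing to \<open>opp d\<close> keeps the edge; turning at a vertex is
      governed by the differences.\<close>
    have same: "fst d \<in> y \<longleftrightarrow> fst d \<in> z" if "d \<in> darts E" for d
      using that d0
    proof (induction rule: P.dart_induct)
      case start
      show ?case using G2[OF y] G2[OF z] eq by simp
    next
      case (opp d)
      then show ?case by simp
    next
      case (rot d)
      have "(fst d \<in> y) \<noteq> (fst (\<sigma> d) \<in> y) \<longleftrightarrow> (fst d \<in> z) \<noteq> (fst (\<sigma> d) \<in> z)"
        using G3[OF y rot(1)] G3[OF z rot(1)] eq by simp
      then show ?case using rot(2) by blast
    qed
    have "e \<in> y \<longleftrightarrow> e \<in> z" if "e \<in> E" for e
      using same[of "(e, True)"] that by (simp add: darts_def)
    moreover have "y \<subseteq> E" "z \<subseteq> E" using y z by (simp_all add: straight_edge_sets_def)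
    ultimately show "y = z" by blast
  qed
  moreover have "finite (straight_edge_sets E \<sigma>')"
    using P.finite_E by (intro finite_subset[of "straight_edge_sets E \<sigma>'" "Pow E"]) (auto simp: straight_edge_sets_def)
  ultimately show ?thesis using G1 by (intro card_inj_on_le[of G]) auto
qed

theorem mainTheorem3:
  fixes V :: "'v set" and E :: "'e set" and ends :: "'e \<Rightarrow> 'v \<times> 'v"
    and \<sigma> \<sigma>' :: "'e \<times> bool \<Rightarrow> 'e \<times> bool" and C C' :: "'e set set"
  assumes "multigraph V E ends"
    and "four_regular V E ends"
    and "two_connected V E ends"
    and "planar_embedding V E ends \<sigma>"
    and "planar_embedding V E ends \<sigma>'"
    and "threaded_circuit_partition E ends \<sigma> C"
    and "threaded_circuit_partition E ends \<sigma>' C'"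
  shows "card C = card C'"
proof -
  \<comment> \<open>Two-connectedness supplies connectedness and, through
    \<open>3 \<le> card V\<close>, a vertex.\<close>
  have plane: "four_regular_plane V E ends \<tau>" if "planar_embedding V E ends \<tau>" for \<tau>
    using assms(1-3) that by unfold_locales (auto simp: two_connected_def planar_embedding_def)
  note P = plane[OF assms(4)] and Q = plane[OF assms(5)]
  interpret P: four_regular_plane V E ends \<sigma> by (rule P)
  interpret Q: four_regular_plane V E ends \<sigma>' by (rule Q)
  have "card (straight_edge_sets E \<sigma>) = card (straight_edge_sets E \<sigma>')"
    using card_straight_le[OF P Q] card_straight_le[OF Q P] by simp
  then have "(2::nat) ^ card C = 2 ^ card C'"
    using P.card_straight_edge_sets[OF assms(6)] Q.card_straight_edge_sets[OF assms(7)] by simp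
  then show ?thesis by simp
qed

end
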